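(* Let $C_l,C_g>0$ be constants independent of $p$ and $w$, let $N_J\ge1$ be an integer independent of $p$ and $w$, and for an integer $p\ge1$ and a weight vector $w=(w_1,\dots,w_p)$ with positive entries let $$C_M(w)=C_l\,L(w)^{N_J}\bigl(1+C_g\,G(w)\bigr),\qquad L(w)=C_1(p)+\sum_{k=1}^p\frac1{w_k},\qquad G(w)=\sum_{k=1}^pw_k\frac{p^{4k+2}}{(2k+1)(k!)^2}.$$ Then there is a constant $C_0>0$, not depending on $p$ or $w$, such that for all $p\ge1$ and all such $w$, $$C_M(w)\ge C_0\,P(p),\qquad P(p)=\sum_{k=1}^p\frac{p^{4k+2}}{(k!)^2(2k+1)},$$ where $P(p)$ is independent of the choice of weights $w$.
   Context: $C_M(w)$ is the factor in the upper bound $\kappa(\mathcal{M})\le C_M(w)\kappa(\mathcal{M}^* )$ for the condition number of a stabilized mass matrix of a cut finite element method with tensor-product elements of degree $p$ and jump-penalty weights $w_k$; here only the displayed formula for $C_M(w)$ matters. $C_1(p)$ is a constant depending on $p$ but not on the mesh size $h$ such that for any two axis-aligned hypercubes $T_1,T_2\subset\mathbb{R}^d$ of side $h$ sharing a $(d-1)$-dimensional face, every polynomial $q$ of degree at most $p$ in each variable satisfies $\|q\|_{L_2(T_1)}^2\le C_1(p)\|q\|_{L_2(T_2)}^2$. In particular (taking $q=1$) $C_1(p)\ge1$. *)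

theory Defs
  imports "HOL-Analysis.Analysis"
begin

definition axis_hypercube :: "real \<Rightarrow> (real ^ 'd) set \<Rightarrow> bool" where
  "axis_hypercube h T \<longleftrightarrow> (\<exists>a. T = cbox a (a + (\<chi> i. h)))"

definition share_facet :: "(real ^ 'd) set \<Rightarrow> (real ^ 'd) set \<Rightarrow> bool" where
  "share_facet T1 T2 \<longleftrightarrow> T1 \<noteq> T2 \<and> (\<exists>F. F facet_of T1 \<and> F facet_of T2)"

(* Polynomial functions of degree at most p in each variable separately;
   \<alpha> ranges over the multi-indices, c \<alpha> is the coefficient of the monomial x^\<alpha>. *)
definition tensor_polys :: "nat \<Rightarrow> (real ^ 'd \<Rightarrow> real) set" where
  "tensor_polys p =
     {q. \<exists>c :: ('d \<Rightarrow> nat) \<Rightarrow> real.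
        \<forall>x. q x = (\<Sum>\<alpha> | \<forall>i. \<alpha> i \<le> p. c \<alpha> * (\<Prod>i\<in>UNIV. (x $ i) ^ \<alpha> i))}"

definition L2_norm_on :: "(real ^ 'd) set \<Rightarrow> (real ^ 'd \<Rightarrow> real) \<Rightarrow> real" where
  "L2_norm_on T q = sqrt (LINT x:T|lborel. (q x)\<^sup>2)"

(* Weight vectors (w_1, ..., w_p) are functions on nat of which only the
   values at 1, ..., p are used. *)
definition L_fun :: "(nat \<Rightarrow> real) \<Rightarrow> nat \<Rightarrow> (nat \<Rightarrow> real) \<Rightarrow> real" where
  "L_fun C1 p w = C1 p + (\<Sum>k=1..p. 1 / w k)"

definition G_fun :: "nat \<Rightarrow> (nat \<Rightarrow> real) \<Rightarrow> real" where
  "G_fun p w = (\<Sum>k=1..p. w k * (real p ^ (4 * k + 2) / ((2 * real k + 1) * (fact k)\<^sup>2)))"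

definition C_M ::
  "real \<Rightarrow> real \<Rightarrow> nat \<Rightarrow> (nat \<Rightarrow> real) \<Rightarrow> nat \<Rightarrow> (nat \<Rightarrow> real) \<Rightarrow> real" where
  "C_M Cl Cg NJ C1 p w = Cl * L_fun C1 p w ^ NJ * (1 + Cg * G_fun p w)"

definition P_fun :: "nat \<Rightarrow> real" where
  "P_fun p = (\<Sum>k=1..p. real p ^ (4 * k + 2) / ((fact k)\<^sup>2 * (2 * real k + 1)))"

end

theory Submission
  imports Defs
begin

text \<open>Since \<open>C1 p \<ge> 1\<close> (test the inequality with \<open>q = 1\<close>), \<open>L w \<ge> 1\<close> and
  hence \<open>L w ^ NJ \<ge> L w\<close>. Every term of \<open>G w\<close> carries a factor \<open>w k\<close> which is
  cancelled by the summand \<open>1 / w k\<close> of \<open>L w\<close>, so \<open>L w * G w \<ge> P p\<close> for every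
  choice of weights, and \<open>C0 = Cl * Cg\<close> works.\<close>

text \<open>Sums over infinite sets default to 0, so finiteness is what allows the constant term to
  be singled out of the sum in \<open>tensor_polys\<close>.\<close>

lemma finite_bounded_multiindices: "finite {\<alpha> :: 'd::finite \<Rightarrow> nat. \<forall>i. \<alpha> i \<le> p}"
proof -
  have "{\<alpha> :: 'd \<Rightarrow> nat. \<forall>i. \<alpha> i \<le> p} = (\<Pi>\<^sub>E i\<in>UNIV. {..p})"
    by (auto simp: PiE_def Pi_def extensional_def)
  then show ?thesis
    by (simp add: finite_PiE)
qed

text \<open>Take coefficients supported at the zero multi-index, whose monomial is the empty power
  1, even at points with zero coordinates.\<close>

lemma const_in_tensor_polys: "(\<lambda>x :: real ^ 'd. b) \<in> tensor_polys p"
proof -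
  have "(\<Sum>\<alpha> | \<forall>i. \<alpha> i \<le> p. (if \<alpha> = (\<lambda>_. 0) then b else 0) * (\<Prod>i\<in>UNIV. (x $ i) ^ \<alpha> i)) = b"
    for x :: "real ^ 'd"
  proof -
    have "(\<Sum>\<alpha> | \<forall>i. \<alpha> i \<le> p. (if \<alpha> = (\<lambda>_. 0) then b else 0) * (\<Prod>i\<in>UNIV. (x $ i) ^ \<alpha> i))
        = (\<Sum>\<alpha> :: 'd \<Rightarrow> nat | \<forall>i. \<alpha> i \<le> p. if \<alpha> = (\<lambda>_. 0) then b else 0)"
      by (rule sum.cong) auto
    also have "\<dots> = b"
      by (simp add: sum.delta finite_bounded_multiindices)
    finally show ?thesis .
  qed
  then show ?thesis
    unfolding tensor_polys_def mem_Collect_eq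
    by (intro exI[of _ "\<lambda>\<alpha>. if \<alpha> = (\<lambda>_. 0) then b else 0"]) simp
qed

text \<open>A supporting hyperplane cuts out a face. Since this face contains a nonempty relatively
  open piece of the hyperplane, it has the full dimension of the hyperplane, one less than that of
  \<open>T\<close>.\<close>

lemma facet_of_convex_touching_hyperplane:
  fixes T U :: "'a::euclidean_space set"
  assumes "convex T" and "interior T \<noteq> {}" and "v \<noteq> 0"
    and le: "\<And>x. x \<in> T \<Longrightarrow> v \<bullet> x \<le> b"
    and "open U" and "{x. v \<bullet> x = b} \<inter> U \<noteq> {}" and "{x. v \<bullet> x = b} \<inter> U \<subseteq> T"
  shows "(T \<inter> {x. v \<bullet> x = b}) facet_of T"
proof -
  let ?H = "{x. v \<bullet> x = b}"
  have "aff_dim (?H \<inter> U) = aff_dim ?H"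
    using assms by (intro aff_dim_convex_Int_open convex_hyperplane)
  moreover have "aff_dim (?H \<inter> U) \<le> aff_dim (T \<inter> ?H)" "aff_dim (T \<inter> ?H) \<le> aff_dim ?H"
    using assms(7) by (intro aff_dim_subset; blast)+
  moreover have "aff_dim ?H = aff_dim T - 1"
    using assms by (simp add: aff_dim_hyperplane aff_dim_nonempty_interior)
  moreover have "(T \<inter> ?H) face_of T"
    using assms by (intro face_of_Int_supporting_hyperplane_le)
  moreover have "T \<inter> ?H \<noteq> {}"
    using assms by blast
  ultimately show ?thesis
    by (simp add: facet_of_def)
qed

text \<open>Supplies concrete neighbours to which the comparison inequality can be applied. The
  common facet lies in the hyperplane where coordinate \<open>j\<close> equals
  \<open>a $ j + h\<close>.\<close>

lemma share_facet_translate_axis: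
  fixes a :: "real ^ 'd"
  assumes "h > 0"
  shows "share_facet (cbox a (a + (\<chi> i. h))) (cbox (a + axis j h) (a + axis j h + (\<chi> i. h)))"
    (is "share_facet ?T1 ?T2")
proof -
  define H where "H = {x :: real ^ 'd. axis j 1 \<bullet> x = a $ j + h}"
  \<comment> \<open>\<open>U\<close> is the interior of the union of the two cubes, so it meets
    \<open>H\<close> in the relative interior of the common facet. The witness in \<open>mid\<close>
    is the centre of that facet.\<close>
  define U where "U = box a (a + axis j h + (\<chi> i. h))"
  have mid: "a + (\<chi> i. h / 2) + axis j (h / 2) \<in> H \<inter> U"
  proof
    show "a + (\<chi> i. h / 2) + axis j (h / 2) \<in> H"
      by (simp add: H_def inner_axis')
    show "a + (\<chi> i. h / 2) + axis j (h / 2) \<in> U"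
      using assms by (auto simp: U_def mem_box_cart axis_def)
  qed
  \<comment> \<open>The second cube lies on the other side of \<open>H\<close>, so its supporting
    inequality needs the opposite normal.\<close>
  have H_neg: "H = {x. - axis j 1 \<bullet> x = - (a $ j + h)}"
    by (auto simp: H_def)
  have U_sub: "H \<inter> U \<subseteq> ?T1" "H \<inter> U \<subseteq> ?T2"
  proof -
    have "x \<in> ?T1 \<and> x \<in> ?T2" if "x \<in> H \<inter> U" for x
    proof -
      have x: "x $ j = a $ j + h" "a $ i < x $ i" "x $ i < a $ i + axis j h $ i + h" for i
        using that by (auto simp: H_def U_def mem_box_cart inner_axis')
      have "a $ i + axis j h $ i \<le> x $ i \<and> x $ i \<le> a $ i + h" for i
        using x(1) x(2,3)[of i] assms by (cases "i = j") (auto simp: axis_def)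
      then show ?thesis
        using x(2,3) by (auto simp: mem_box_cart less_imp_le)
    qed
    then show "H \<inter> U \<subseteq> ?T1" "H \<inter> U \<subseteq> ?T2"
      by blast+
  qed
  have "interior ?T1 \<noteq> {}" "interior ?T2 \<noteq> {}"
    using assms by (auto simp: interior_cbox interval_ne_empty_cart not_le)
  have 1: "(?T1 \<inter> H) facet_of ?T1"
    unfolding H_def
  proof (rule facet_of_convex_touching_hyperplane)
    show "{x. axis j 1 \<bullet> x = a $ j + h} \<inter> U \<noteq> {}"
      using mid by (auto simp: H_def)
    show "{x. axis j 1 \<bullet> x = a $ j + h} \<inter> U \<subseteq> ?T1"
      using U_sub(1) by (simp add: H_def)
  qed (use \<open>interior ?T1 \<noteq> {}\<close> in \<open>auto simp: U_def mem_box_cart inner_axis' axis_eq_0_iff\<close>)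
  have 2: "(?T2 \<inter> H) facet_of ?T2"
    unfolding H_neg
  proof (rule facet_of_convex_touching_hyperplane)
    show "{x. - axis j 1 \<bullet> x = - (a $ j + h)} \<inter> U \<noteq> {}"
      using mid unfolding H_neg by auto
    show "{x. - axis j 1 \<bullet> x = - (a $ j + h)} \<inter> U \<subseteq> ?T2"
      using U_sub(2) by (simp add: H_neg)
    show "- axis j 1 \<bullet> x \<le> - (a $ j + h)" if "x \<in> ?T2" for x
      using that by (auto simp: mem_box_cart inner_axis' dest!: spec[of _ j])
  qed (use \<open>interior ?T2 \<noteq> {}\<close> in \<open>auto simp: U_def axis_eq_0_iff\<close>)
  have "?T1 \<inter> H = ?T2 \<inter> H"
  proof (intro set_eqI)
    fix x
    \<comment> \<open>For \<open>i\<close> other than \<open>j\<close> the bounds of both cubes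
      coincide; for \<open>i = j\<close> both hold because the coordinate is fixed on
      \<open>H\<close>.\<close>
    have "(a $ i \<le> x $ i \<and> x $ i \<le> a $ i + h) \<longleftrightarrow>
        (a $ i + axis j h $ i \<le> x $ i \<and> x $ i \<le> a $ i + axis j h $ i + h)"
      if "x $ j = a $ j + h" for i
      using that assms by (auto simp: axis_def)
    then show "x \<in> ?T1 \<inter> H \<longleftrightarrow> x \<in> ?T2 \<inter> H"
      by (auto simp: H_def mem_box_cart inner_axis')
  qed
  \<comment> \<open>The corner \<open>a\<close> shows that the two cubes are distinct, as
    \<open>share_facet\<close> demands.\<close>
  moreover have "a \<in> ?T1" "a \<notin> ?T2"
    using assms by (auto simp: mem_box_cart intro!: exI[of _ j])
  ultimately show ?thesis
    unfolding share_facet_def using 1 2 by metis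
qed

lemma L2_norm_on_const_hypercube:
  assumes "axis_hypercube h (T :: (real ^ 'd) set)" and "h > 0"
  shows "(L2_norm_on T (\<lambda>_. 1))\<^sup>2 = h ^ CARD('d)"
proof -
  obtain a where T: "T = cbox a (a + (\<chi> i. h))"
    using assms(1) by (auto simp: axis_hypercube_def)
  have "measure lborel T = h ^ CARD('d)"
    using assms(2) unfolding T by (subst content_cbox_cart) (auto simp: interval_ne_empty_cart)
  then show ?thesis
    using assms(2) by (simp add: L2_norm_on_def set_lebesgue_integral_def T)
qed

text \<open>Apply the inequality to two adjacent unit cubes and the constant 1: both squared norms
  are 1, which leaves \<open>1 \<le> K\<close>.\<close>

lemma facet_comparison_constant_ge_1:
  fixes K :: real
  assumes "\<And>h (T1 :: (real ^ 'd) set) T2 q.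
      h > 0 \<Longrightarrow> axis_hypercube h T1 \<Longrightarrow> axis_hypercube h T2 \<Longrightarrow>
      share_facet T1 T2 \<Longrightarrow> q \<in> tensor_polys p \<Longrightarrow>
      (L2_norm_on T1 q)\<^sup>2 \<le> K * (L2_norm_on T2 q)\<^sup>2"
  shows "K \<ge> 1"
proof -
  \<comment> \<open>This only names some coordinate direction; the index type is nonempty.\<close>
  obtain j :: 'd where True by blast
  let ?T1 = "cbox 0 (0 + (\<chi> i. 1)) :: (real ^ 'd) set"
  let ?T2 = "cbox (0 + axis j 1) (0 + axis j 1 + (\<chi> i. 1)) :: (real ^ 'd) set"
  have cubes: "axis_hypercube 1 ?T1" "axis_hypercube 1 ?T2"
    unfolding axis_hypercube_def by blast+
  have "(L2_norm_on ?T1 (\<lambda>_. 1))\<^sup>2 \<le> K * (L2_norm_on ?T2 (\<lambda>_. 1))\<^sup>2"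
    by (rule assms[OF zero_less_one cubes share_facet_translate_axis[OF zero_less_one]
          const_in_tensor_polys])
  then show ?thesis
    using L2_norm_on_const_hypercube[OF cubes(1)] L2_norm_on_const_hypercube[OF cubes(2)] by simp
qed

lemma P_fun_le_L_fun_mult_G_fun:
  assumes "C1 p \<ge> 0" and pos: "\<forall>k\<in>{1..p}. w k > 0"
  shows "P_fun p \<le> L_fun C1 p w * G_fun p w"
proof -
  have "P_fun p \<le> (\<Sum>k=1..p. L_fun C1 p w *
      (w k * (real p ^ (4 * k + 2) / ((2 * real k + 1) * (fact k)\<^sup>2))))"
    unfolding P_fun_def
  proof (rule sum_mono)
    fix k assume k: "k \<in> {1..p}"
    let ?r = "real p ^ (4 * k + 2) / ((2 * real k + 1) * (fact k)\<^sup>2)"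
    \<comment> \<open>All summands of \<open>L_fun\<close> other than this reciprocal are
      nonnegative and are discarded, separately for each \<open>k\<close>.\<close>
    have "1 / w k \<le> (\<Sum>k=1..p. 1 / w k)"
      using k pos by (intro member_le_sum) (auto simp: less_imp_le)
    then have "1 / w k \<le> L_fun C1 p w"
      using assms(1) by (simp add: L_fun_def)
    moreover have "0 \<le> w k * ?r"
      using k pos by (simp add: less_imp_le)
    ultimately have "1 / w k * (w k * ?r) \<le> L_fun C1 p w * (w k * ?r)"
      by (rule mult_right_mono)
    moreover have "w k \<noteq> 0"
      using k pos by force
    ultimately show "real p ^ (4 * k + 2) / ((fact k)\<^sup>2 * (2 * real k + 1))
        \<le> L_fun C1 p w * (w k * ?r)"
      by (simp add: mult.commute)
  qed
  then show ?thesis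
    by (simp add: G_fun_def sum_distrib_left)
qed

theorem lemma6:
  fixes Cl Cg :: real and NJ :: nat and C1 :: "nat \<Rightarrow> real"
  assumes "Cl > 0" and "Cg > 0" and "NJ \<ge> 1"
    and "\<And>p h (T1 :: (real ^ 'd) set) T2 q.
      p \<ge> 1 \<Longrightarrow> h > 0 \<Longrightarrow> axis_hypercube h T1 \<Longrightarrow> axis_hypercube h T2 \<Longrightarrow>
      share_facet T1 T2 \<Longrightarrow> q \<in> tensor_polys p \<Longrightarrow>
      (L2_norm_on T1 q)\<^sup>2 \<le> C1 p * (L2_norm_on T2 q)\<^sup>2"
  shows "\<exists>C0 > 0. \<forall>p \<ge> 1. \<forall>w :: nat \<Rightarrow> real. (\<forall>k\<in>{1..p}. w k > 0) \<longrightarrow>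
           C_M Cl Cg NJ C1 p w \<ge> C0 * P_fun p"
proof (intro exI[of _ "Cl * Cg"] conjI allI impI)
  show "Cl * Cg > 0"
    using assms(1,2) by simp
next
  fix p :: nat and w :: "nat \<Rightarrow> real"
  assume p: "p \<ge> 1" and pos: "\<forall>k\<in>{1..p}. w k > 0"
  let ?L = "L_fun C1 p w" and ?G = "G_fun p w"
  have C1: "C1 p \<ge> 1"
    using assms(4)[OF p] by (rule facet_comparison_constant_ge_1)
  have "(\<Sum>k=1..p. 1 / w k) \<ge> 0"
    using pos by (intro sum_nonneg) (auto simp: less_imp_le)
  then have L: "?L \<ge> 1"
    using C1 by (simp add: L_fun_def)
  have G: "?G \<ge> 0"
    unfolding G_fun_def using pos by (intro sum_nonneg) (auto simp: less_imp_le)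
  have "Cl * Cg * P_fun p \<le> Cl * Cg * (?L * ?G)"
    using assms(1,2) C1 pos by (intro mult_left_mono P_fun_le_L_fun_mult_G_fun) auto
  also have "\<dots> = Cl * ?L * (Cg * ?G)"
    by simp
  \<comment> \<open>Here \<open>?L \<le> ?L ^ NJ\<close> because \<open>?L \<ge> 1\<close> and
    \<open>NJ \<ge> 1\<close>, and adding 1 to the last factor only enlarges it.\<close>
  also have "\<dots> \<le> Cl * ?L ^ NJ * (1 + Cg * ?G)"
    using assms(1-3) L G by (intro mult_mono mult_left_mono self_le_power) auto
  finally show "C_M Cl Cg NJ C1 p w \<ge> Cl * Cg * P_fun p"
    by (simp add: C_M_def)
qed

end
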